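(* Let $\Gamma\in\mathscr G_3$, i.e. let $\Gamma$ be a connected graph with precisely three distinct eigenvalues. Then the coherent rank of $\Gamma$ is not $7$.
   Context: All graphs are finite, undirected and simple; the eigenvalues of a graph are those of its adjacency matrix $A(\Gamma)$. $\mathscr G_3$ denotes the set of all connected graphs having precisely three distinct eigenvalues. A coherent algebra on a finite set $X$ is a matrix algebra $\mathcal A\subset \operatorname{Mat}_X(\mathbb C)$ that contains the identity matrix $I$ and the all-ones matrix $J$, and is closed under transposition, ordinary matrix multiplication and entrywise multiplication. Each coherent algebra has a unique linear basis consisting of $\{0,1\}$-matrices whose sum is $J$; the number of these matrices is the rank of $\mathcal A$. The coherent closure $\mathcal W(\Gamma)$ of $\Gamma$ is the smallest coherent algebra containing $A(\Gamma)$, and the coherent rank of $\Gamma$ is the rank of $\mathcal W(\Gamma)$. *)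

theory Defs
  imports "HOL-Analysis.Analysis"
begin

section \<open>Graphs and eigenvalues\<close>

text \<open>
  A graph is given by its adjacency relation on a finite vertex type; being finite, undirected
  and simple amounts to symmetry and irreflexivity of this relation.
\<close>

definition simple_graph :: "('v::finite \<Rightarrow> 'v \<Rightarrow> bool) \<Rightarrow> bool" where
  "simple_graph E \<longleftrightarrow> symp E \<and> irreflp E"

definition connected_graph :: "('v::finite \<Rightarrow> 'v \<Rightarrow> bool) \<Rightarrow> bool" where
  "connected_graph E \<longleftrightarrow> (\<forall>u v. E\<^sup>*\<^sup>* u v)"

definition adjacency_matrix :: "('v::finite \<Rightarrow> 'v \<Rightarrow> bool) \<Rightarrow> complex^'v^'v" where
  "adjacency_matrix E = (\<chi> u v. of_bool (E u v))"

definition eigenvalues :: "complex^'v^'v \<Rightarrow> complex set" where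
  "eigenvalues M = {c. \<exists>x. x \<noteq> 0 \<and> M *v x = c *s x}"

definition three_eigenvalue_graphs :: "('v::finite \<Rightarrow> 'v \<Rightarrow> bool) set" where
  "three_eigenvalue_graphs =
     {E. simple_graph E \<and> connected_graph E \<and> card (eigenvalues (adjacency_matrix E)) = 3}"


section \<open>Coherent algebras\<close>

definition scale_matrix :: "complex \<Rightarrow> complex^'v^'v \<Rightarrow> complex^'v^'v" where
  "scale_matrix c M = (\<chi> u v. c * M $ u $ v)"

global_interpretation cmat: vector_space "scale_matrix :: complex \<Rightarrow> complex^'v^'v \<Rightarrow> _"
  by unfold_locales (simp_all add: scale_matrix_def vec_eq_iff algebra_simps)

definition all_ones :: "complex^'v^'v" where
  "all_ones = (\<chi> u v. 1)"

definition entrywise_mult :: "complex^'v^'v \<Rightarrow> complex^'v^'v \<Rightarrow> complex^'v^'v" where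
  "entrywise_mult M N = (\<chi> u v. M $ u $ v * N $ u $ v)"

definition coherent_algebra :: "(complex^'v^'v) set \<Rightarrow> bool" where
  "coherent_algebra \<A> \<longleftrightarrow>
     cmat.subspace \<A> \<and> mat 1 \<in> \<A> \<and> all_ones \<in> \<A> \<and>
     (\<forall>M\<in>\<A>. transpose M \<in> \<A>) \<and>
     (\<forall>M\<in>\<A>. \<forall>N\<in>\<A>. M ** N \<in> \<A>) \<and>
     (\<forall>M\<in>\<A>. \<forall>N\<in>\<A>. entrywise_mult M N \<in> \<A>)"

definition standard_basis :: "(complex^'v^'v) set \<Rightarrow> (complex^'v^'v) set \<Rightarrow> bool" where
  "standard_basis \<A> B \<longleftrightarrow>
     B \<subseteq> \<A> \<and> cmat.independent B \<and> cmat.span B = \<A> \<and>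
     (\<forall>M\<in>B. \<forall>u v. M $ u $ v \<in> {0, 1}) \<and> finite B \<and> \<Sum>B = all_ones"

text \<open>
  The definite description is justified by \<open>ex1_standard_basis\<close> below.
\<close>

definition algebra_rank :: "(complex^'v^'v) set \<Rightarrow> nat" where
  "algebra_rank \<A> = card (THE B. standard_basis \<A> B)"

definition coherent_closure :: "('v::finite \<Rightarrow> 'v \<Rightarrow> bool) \<Rightarrow> (complex^'v^'v) set" where
  "coherent_closure E = \<Inter>{\<A>. coherent_algebra \<A> \<and> adjacency_matrix E \<in> \<A>}"

definition coherent_rank :: "('v::finite \<Rightarrow> 'v \<Rightarrow> bool) \<Rightarrow> nat" where
  "coherent_rank E = algebra_rank (coherent_closure E)"


section \<open>Well-definedness of closure and rank\<close>

lemma coherent_algebra_coherent_closure: "coherent_algebra (coherent_closure E)"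
  unfolding coherent_algebra_def coherent_closure_def
  by (auto intro!: cmat.subspace_Inter)

lemma adjacency_matrix_in_coherent_closure: "adjacency_matrix E \<in> coherent_closure E"
  by (auto simp: coherent_closure_def)

lemma coherent_closure_least:
  "coherent_algebra \<A> \<Longrightarrow> adjacency_matrix E \<in> \<A> \<Longrightarrow> coherent_closure E \<subseteq> \<A>"
  by (auto simp: coherent_closure_def)

text \<open>
  The standard basis consists of the indicator matrices of the classes of entries that are not
  separated by any matrix of the algebra.
\<close>

definition indicator_class :: "(complex^'v^'v) set \<Rightarrow> 'v \<Rightarrow> 'v \<Rightarrow> complex^'v^'v" where
  "indicator_class \<A> u v =
     (\<chi> x y. of_bool (\<forall>M\<in>\<A>. M $ x $ y = M $ u $ v))"

lemma entrywise_prod_in: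
  assumes "coherent_algebra \<A>" "finite S" "\<And>s. s \<in> S \<Longrightarrow> F s \<in> \<A>"
  shows "(\<chi> x y. \<Prod>s\<in>S. F s $ x $ y) \<in> \<A>"
  using assms(2,3)
proof (induction S)
  case empty
  then show ?case using assms(1) by (simp add: coherent_algebra_def all_ones_def)
next
  case (insert s S)
  then have "entrywise_mult (F s) (\<chi> x y. \<Prod>s\<in>S. F s $ x $ y) \<in> \<A>"
    using assms(1) by (simp add: coherent_algebra_def)
  then show ?case using insert by (simp add: entrywise_mult_def)
qed

lemma indicator_class_in:
  fixes \<A> :: "(complex^'v^'v) set"
  assumes coh: "coherent_algebra \<A>"
  shows "indicator_class \<A> u v \<in> \<A>"
proof -
  have sub: "cmat.subspace \<A>" and J: "all_ones \<in> \<A>"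
    using coh by (auto simp: coherent_algebra_def)
  define S where "S = {(x, y). \<exists>M\<in>\<A>. M $ x $ y \<noteq> M $ u $ v}"
  have "\<exists>F\<in>\<A>. F $ u $ v = 1 \<and> F $ fst p $ snd p = 0" if p: "p \<in> S" for p
  proof -
    obtain M where M: "M \<in> \<A>" "M $ fst p $ snd p \<noteq> M $ u $ v"
      using p by (auto simp: S_def)
    define m where "m = M $ fst p $ snd p"
    define F where "F = scale_matrix (1 / (M $ u $ v - m)) (M - scale_matrix m all_ones)"
    have "F \<in> \<A>" unfolding F_def
      by (intro cmat.subspace_scale cmat.subspace_diff sub M J)
    moreover have "F $ u $ v = 1" "F $ fst p $ snd p = 0"
      using M by (auto simp: F_def m_def scale_matrix_def all_ones_def)
    ultimately show ?thesis by blast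
  qed
  then obtain F where F: "\<And>p. p \<in> S \<Longrightarrow> F p \<in> \<A>"
    "\<And>p. p \<in> S \<Longrightarrow> F p $ u $ v = 1" "\<And>p. p \<in> S \<Longrightarrow> F p $ fst p $ snd p = 0"
    by metis
  have "indicator_class \<A> u v = (\<chi> x y. \<Prod>p\<in>S. F p $ x $ y)"
  proof -
    have "of_bool (\<forall>M\<in>\<A>. M $ x $ y = M $ u $ v) = (\<Prod>p\<in>S. F p $ x $ y)" for x y
    proof (cases "(x, y) \<in> S")
      case True
      then have "(\<Prod>p\<in>S. F p $ x $ y) = 0"
        using F(3)[of "(x, y)"] by (intro prod_zero) auto
      then show ?thesis using True by (auto simp: S_def)
    next
      case False
      then have *: "\<forall>M\<in>\<A>. M $ x $ y = M $ u $ v" by (auto simp: S_def)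
      then have "(\<Prod>p\<in>S. F p $ x $ y) = 1" using F by (intro prod.neutral) simp
      then show ?thesis using * by simp
    qed
    then show ?thesis by (simp add: indicator_class_def)
  qed
  then show ?thesis using entrywise_prod_in[OF coh, of S F] F(1) by simp
qed

lemma zero_one_partition:
  fixes B :: "(complex^'v^'v) set"
  assumes "finite B" "\<forall>M\<in>B. \<forall>u v. M $ u $ v \<in> {0, 1}" "\<Sum>B = all_ones"
  shows "\<exists>!M. M \<in> B \<and> M $ u $ v = 1"
proof -
  define C where "C = {M \<in> B. M $ u $ v = 1}"
  have "(1::complex) = (\<Sum>M\<in>B. M $ u $ v)"
    using arg_cong[OF assms(3), of "\<lambda>N. N $ u $ v"] by (simp add: all_ones_def)
  also have "\<dots> = (\<Sum>M\<in>B. of_bool (M $ u $ v = 1))"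
  proof (intro sum.cong refl)
    fix M assume "M \<in> B"
    then have "M $ u $ v \<in> {0, 1}" using assms(2) by blast
    then show "M $ u $ v = of_bool (M $ u $ v = 1)" by auto
  qed
  also have "\<dots> = of_nat (card C)"
    using assms(1) by (simp add: C_def Int_def)
  finally have "card C = 1" using of_nat_eq_1_iff[of "card C", where ?'a = complex] by simp
  then obtain N where "C = {N}" by (auto simp: card_1_singleton_iff)
  then have "M \<in> B \<and> M $ u $ v = 1 \<longleftrightarrow> M = N" for M
    unfolding C_def by blast
  then show ?thesis by simp
qed

lemma standard_basis_unique:
  assumes "standard_basis \<A> B"
  shows "B = range (\<lambda>(u, v). indicator_class \<A> u v)"
proof -
  have B: "B \<subseteq> \<A>" "cmat.independent B" "cmat.span B = \<A>" "finite B"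
    "\<forall>M\<in>B. \<forall>u v. M $ u $ v \<in> {0, 1}" "\<Sum>B = all_ones"
    using assms by (auto simp: standard_basis_def)
  note part = zero_one_partition[OF B(4,5,6)]
  have const: "N $ x $ y = N $ u $ v"
    if M: "M \<in> B" "M $ u $ v = 1" "M $ x $ y = 1" and N: "N \<in> \<A>" for M N u v x y
  proof -
    from N have "N \<in> cmat.span B" using B(3) by simp
    then show ?thesis
    proof (induction rule: cmat.span_induct_alt)
      case base
      show ?case by simp
    next
      case (step c K L)
      have "K $ x $ y = K $ u $ v"
      proof (cases "K = M")
        case False
        then have "K $ x $ y \<noteq> 1" "K $ u $ v \<noteq> 1"
          using part[of x y] part[of u v] M step(1) by auto
        then show ?thesis using B(5) step(1) by (metis insert_iff singletonD)
      qed (use M in simp)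
      then show ?case using step(2) by (simp add: scale_matrix_def)
    qed
  qed
  have eq: "indicator_class \<A> u v = M" if M: "M \<in> B" "M $ u $ v = 1" for M u v
  proof -
    have "of_bool (\<forall>N\<in>\<A>. N $ x $ y = N $ u $ v) = M $ x $ y" for x y
    proof (cases "M $ x $ y = 1")
      case True
      then show ?thesis using const[OF M True] by auto
    next
      case False
      then have "M $ x $ y = 0" using B(5) M(1) by (metis insert_iff singletonD)
      moreover have "\<not> (\<forall>N\<in>\<A>. N $ x $ y = N $ u $ v)"
        using False M B(1) by (metis subsetD)
      ultimately show ?thesis by simp
    qed
    then show ?thesis by (simp add: indicator_class_def)
  qed
  have "M \<in> range (\<lambda>(u, v). indicator_class \<A> u v)" if "M \<in> B" for M
  proof -
    have "M \<noteq> 0" using B(2) that cmat.dependent_zero by metis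
    then obtain u v where "M $ u $ v \<noteq> 0" by (auto simp: vec_eq_iff)
    then have "M $ u $ v = 1" using B(5) that by (metis insert_iff singletonD)
    then show ?thesis using eq[OF that] by force
  qed
  moreover have "indicator_class \<A> u v \<in> B" for u v
    using part[of u v] eq by auto
  ultimately show ?thesis by auto
qed

lemma standard_basis_exists:
  fixes \<A> :: "(complex^'v^'v) set"
  assumes coh: "coherent_algebra \<A>"
  shows "standard_basis \<A> (range (\<lambda>(u, v). indicator_class \<A> u v))"
proof -
  define B where "B = range (\<lambda>(u, v). indicator_class \<A> u v)"
  have sub: "cmat.subspace \<A>" using coh by (simp add: coherent_algebra_def)
  have fin: "finite B" by (simp add: B_def)
  have BA: "B \<subseteq> \<A>" using indicator_class_in[OF coh] by (auto simp: B_def)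
  have B01: "\<forall>M\<in>B. \<forall>u v. M $ u $ v \<in> {0, 1}"
    by (auto simp: B_def indicator_class_def)
  have entry: "M $ x $ y = of_bool (M = indicator_class \<A> x y)" if MB: "M \<in> B" for M x y
  proof -
    obtain u v where M: "M = indicator_class \<A> u v" using MB by (auto simp: B_def)
    have "(\<forall>N\<in>\<A>. N $ x $ y = N $ u $ v) \<longleftrightarrow> indicator_class \<A> u v = indicator_class \<A> x y"
      (is "?l \<longleftrightarrow> ?r")
    proof
      assume ?l then show ?r by (simp add: indicator_class_def)
    next
      assume ?r
      then have "indicator_class \<A> u v $ x $ y = indicator_class \<A> x y $ x $ y" by simp
      then show ?l by (simp add: indicator_class_def split: if_splits)
    qed
    then show ?thesis by (simp add: M) (simp add: indicator_class_def)
  qed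
  have IB: "indicator_class \<A> x y \<in> B" for x y by (auto simp: B_def)
  have comb: "(\<Sum>M\<in>B. scale_matrix (f M) M) $ x $ y = f (indicator_class \<A> x y)" for f x y
  proof -
    have "(\<Sum>M\<in>B. scale_matrix (f M) M) $ x $ y = (\<Sum>M\<in>B. f M * M $ x $ y)"
      by (simp add: scale_matrix_def)
    also have "\<dots> = (\<Sum>M\<in>B. if M = indicator_class \<A> x y then f M else 0)"
      by (intro sum.cong) (auto simp: entry)
    finally show ?thesis using fin IB by simp
  qed
  have sumB: "\<Sum>B = all_ones"
    using comb[of "\<lambda>_. 1"] by (simp add: vec_eq_iff all_ones_def)
  have ind: "cmat.independent B"
  proof (rule cmat.independent_if_scalars_zero[OF fin])
    fix f M assume f: "(\<Sum>x\<in>B. scale_matrix (f x) x) = 0" and "M \<in> B"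
    then obtain u v where "M = indicator_class \<A> u v" by (auto simp: B_def)
    then show "f M = 0" using comb[of f u v] f by simp
  qed
  have "M \<in> cmat.span B" if M: "M \<in> \<A>" for M
  proof -
    define f where "f K = M $ fst (SOME p. K = indicator_class \<A> (fst p) (snd p))
      $ snd (SOME p. K = indicator_class \<A> (fst p) (snd p))" for K
    have "f (indicator_class \<A> x y) = M $ x $ y" for x y
    proof -
      define p where "p = (SOME p. indicator_class \<A> x y = indicator_class \<A> (fst p) (snd p))"
      have "indicator_class \<A> x y = indicator_class \<A> (fst p) (snd p)"
        unfolding p_def by (rule someI[of _ "(x, y)"]) simp
      then have "indicator_class \<A> (fst p) (snd p) $ x $ y = 1"
        using entry[OF IB, of "fst p" "snd p" x y] by simp
      then have "M $ x $ y = M $ fst p $ snd p"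
        using M by (simp add: indicator_class_def)
      then show ?thesis by (simp add: f_def p_def)
    qed
    then have "M = (\<Sum>K\<in>B. scale_matrix (f K) K)"
      using comb[of f] by (simp add: vec_eq_iff)
    then show ?thesis
      by (metis (mono_tags, lifting) cmat.span_base cmat.span_scale cmat.span_sum)
  qed
  then have "cmat.span B = \<A>" using cmat.span_minimal[OF BA sub] by auto
  then have "standard_basis \<A> B"
    using BA ind B01 fin sumB by (simp add: standard_basis_def)
  then show ?thesis by (simp add: B_def)
qed

theorem ex1_standard_basis: "coherent_algebra \<A> \<Longrightarrow> \<exists>!B. standard_basis \<A> B"
  using standard_basis_exists standard_basis_unique by metis

end

theory Submission
  imports Defs
begin

text \<open>
  Let \<open>A\<close> be the adjacency matrix of a connected graph with largest eigenvalue \<open>\<theta>\<^sub>0\<close> and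
  two further eigenvalues \<open>\<theta>\<^sub>1\<close> and \<open>\<theta>\<^sub>2\<close>. The matrix
  \<open>(A - \<theta>\<^sub>1 I) (A - \<theta>\<^sub>2 I)\<close> maps everything to the \<open>\<theta>\<^sub>0\<close>-eigenspace, which by Perron's argument is spanned by a positive vector. As the matrix is symmetric, it equals \<open>\<alpha> \<alpha>\<^sup>T\<close> for a
  vector \<open>\<alpha>\<close> with positive entries, so \<open>A\<^sup>2 = s A - p I + \<alpha> \<alpha>\<^sup>T\<close> with \<open>s = \<theta>\<^sub>1 + \<theta>\<^sub>2\<close> and
  \<open>p = \<theta>\<^sub>1 \<theta>\<^sub>2\<close> (\<open>three_eigenvalue_walk_count\<close>).

  Let \<open>W\<close> be the coherent closure, and call two vertices equivalent if the two diagonal positions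
  are not separated by \<open>W\<close>; the equivalence classes are the fibres. The diagonal of \<open>A\<^sup>2\<close> shows that
  \<open>\<alpha>\<close> is constant on fibres. If \<open>\<alpha>\<close> is constant, then \<open>I\<close>, \<open>J\<close> and \<open>A\<close> span a coherent algebra
  and the rank is at most 3.

  Suppose now that the rank is 7, so that there is more than one fibre. Three fibres would give at
  least 9 classes of positions that \<open>W\<close> does not separate, so there are exactly two fibres, and the
  positions from one to the other form a single class, since otherwise there
  would be at least 8 classes (\<open>rank_two_fibres_cross\<close>). As the graph is connected, it is the join
  of the graphs induced on the two fibres. The formula for \<open>A\<^sup>2\<close> then shows that the matrices which
  on each fibre are combinations of \<open>I\<close>, \<open>J\<close> and \<open>A\<close>, and which are constant between distinct
  fibres, form a coherent algebra (\<open>coherent_block_algebra\<close>). Hence the class of a pair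
  \<open>(u, v)\<close> is determined by the fibres of \<open>u\<close> and \<open>v\<close>, by whether \<open>u = v\<close> and by whether \<open>u\<close> and
  \<open>v\<close> are adjacent. There are eight conceivable combinations, of which exactly one does not occur:
  one fibre induces a complete or an empty graph on at least two vertices, and the other one has
  an edge. Counting walks of length two then forces \<open>\<alpha>\<close> to take the same value on both fibres
  (\<open>weights_eq\<close>), so \<open>\<alpha>\<close> is constant after all, and this contradicts rank 7.
\<close>


section \<open>Eigenvectors of real symmetric matrices\<close>

lemma symmetric_matrix_inner:
  fixes A :: "real^'n^'n"
  assumes "transpose A = A"
  shows "x \<bullet> (A *v y) = (A *v x) \<bullet> y"
  by (metis assms dot_lmul_matrix transpose_matrix_vector)

text \<open>
  A vector at which the Rayleigh quotient of a symmetric matrix attains an upper bound is an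
  eigenvector, also relative to an invariant subspace.
\<close>

lemma rayleigh_equality_eigenvector:
  fixes A :: "real^'n^'n"
  assumes sym: "transpose A = A" and W: "subspace W"
    and inv: "\<And>x. x \<in> W \<Longrightarrow> A *v x \<in> W"
    and bound: "\<And>y. y \<in> W \<Longrightarrow> y \<bullet> (A *v y) \<le> l * (y \<bullet> y)"
    and x: "x \<in> W" "x \<bullet> (A *v x) = l * (x \<bullet> x)"
  shows "A *v x = l *\<^sub>R x"
proof -
  define w where "w = l *\<^sub>R x - A *v x"
  define b where "b = l * (w \<bullet> w) - w \<bullet> (A *v w)"
  have wW: "w \<in> W"
    unfolding w_def using W inv x(1) by (simp add: subspace_diff subspace_scale)
  have ww: "w \<bullet> w = l * (x \<bullet> w) - w \<bullet> (A *v x)"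
    unfolding w_def by (simp add: inner_diff_left inner_diff_right inner_commute algebra_simps)
  have quad: "0 \<le> 2 * t * (w \<bullet> w) + t\<^sup>2 * b" for t
  proof -
    have "x + t *\<^sub>R w \<in> W" using W x(1) wW by (simp add: subspace_add subspace_scale)
    from bound[OF this]
    have "0 \<le> l * ((x + t *\<^sub>R w) \<bullet> (x + t *\<^sub>R w)) - (x + t *\<^sub>R w) \<bullet> (A *v (x + t *\<^sub>R w))"
      by simp
    also have "\<dots> = 2 * t * (l * (x \<bullet> w) - w \<bullet> (A *v x)) + t\<^sup>2 * b"
      using x(2) symmetric_matrix_inner[OF sym, of x w]
      by (simp add: matrix_vector_right_distrib matrix_vector_mult_scaleR inner_add_left
          inner_add_right b_def inner_commute power2_eq_square algebra_simps)
    finally show ?thesis using ww by simp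
  qed
  \<comment> \<open>A quadratic without constant term that is nonnegative on both sides of zero has no linear
    term; it is enough to look at one small negative argument.\<close>
  have "w \<bullet> w = 0"
  proof (rule ccontr)
    assume "w \<bullet> w \<noteq> 0"
    then have pos: "w \<bullet> w > 0" by simp
    define t where "t = - (w \<bullet> w) / (\<bar>b\<bar> + 1)"
    have tn: "t < 0" using pos by (simp add: t_def divide_neg_pos)
    have "2 * (w \<bullet> w) + t * b \<le> 0"
    proof -
      have "0 \<le> t * (2 * (w \<bullet> w) + t * b)"
        using quad[of t] by (simp add: power2_eq_square algebra_simps)
      then show ?thesis using tn by (simp add: zero_le_mult_iff)
    qed
    moreover have "\<bar>t * b\<bar> \<le> w \<bullet> w"
    proof -
      have "\<bar>t * b\<bar> = (w \<bullet> w) * (\<bar>b\<bar> / (\<bar>b\<bar> + 1))"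
        using pos by (simp add: t_def abs_mult)
      also have "\<dots> \<le> (w \<bullet> w) * 1" by (intro mult_left_mono) auto
      finally show ?thesis by simp
    qed
    ultimately show False using pos by linarith
  qed
  then show ?thesis by (simp add: w_def)
qed

lemma rayleigh_maximum:
  fixes A :: "real^'n^'n"
  assumes sym: "transpose A = A" and W: "subspace W"
    and inv: "\<And>x. x \<in> W \<Longrightarrow> A *v x \<in> W" and z: "z \<in> W" "z \<noteq> 0"
  obtains x l where "x \<in> W" "x \<noteq> 0" "A *v x = l *\<^sub>R x"
    "\<And>y. y \<in> W \<Longrightarrow> y \<bullet> (A *v y) \<le> l * (y \<bullet> y)"
proof -
  define S where "S = sphere 0 1 \<inter> W"
  have "compact S" unfolding S_def using closed_subspace[OF W] by (intro compact_Int_closed) auto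
  moreover have "S \<noteq> {}"
  proof -
    have "(1 / norm z) *\<^sub>R z \<in> S" using z W by (simp add: S_def subspace_scale)
    then show ?thesis by blast
  qed
  moreover have "continuous_on S (\<lambda>y. y \<bullet> (A *v y))"
    by (intro continuous_intros matrix_vector_mult_linear_continuous_on)
  ultimately obtain x where x: "x \<in> S" "\<And>y. y \<in> S \<Longrightarrow> y \<bullet> (A *v y) \<le> x \<bullet> (A *v x)"
    using continuous_attains_sup[of S "\<lambda>y. y \<bullet> (A *v y)"] by blast
  define l where "l = x \<bullet> (A *v x)"
  have xW: "x \<in> W" "norm x = 1" using x(1) by (auto simp: S_def)
  have bound: "y \<bullet> (A *v y) \<le> l * (y \<bullet> y)" if "y \<in> W" for y
  proof (cases "y = 0")
    case False
    define c where "c = norm y"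
    have c: "c > 0" "y \<bullet> y = c * c" using False by (auto simp: c_def dot_square_norm power2_eq_square)
    have "(1 / c) *\<^sub>R y \<in> S" using that W c False by (simp add: S_def subspace_scale c_def)
    from x(2)[OF this] have "y \<bullet> (A *v y) / (c * c) \<le> l"
      by (simp add: l_def matrix_vector_mult_scaleR)
    then show ?thesis using c by (simp add: field_simps)
  qed simp
  have "A *v x = l *\<^sub>R x"
    using xW by (intro rayleigh_equality_eigenvector[OF sym W inv bound])
      (auto simp: l_def dot_square_norm)
  moreover have "x \<noteq> 0" using xW by auto
  ultimately show thesis using that xW bound by blast
qed

text \<open>
  This is diagonalizability in the case of three eigenvalues: if the product were nonzero, its range
  would be an invariant subspace and contain an eigenvector, which the product annihilates; but the
  kernel and the range of a symmetric matrix meet trivially.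
\<close>

lemma symmetric_matrix_annihilated:
  fixes A :: "real^'n^'n"
  assumes sym: "transpose A = A"
    and eig: "\<And>l x. x \<noteq> 0 \<Longrightarrow> A *v x = l *\<^sub>R x \<Longrightarrow> l \<in> {a, b, c}"
  shows "(A - mat a) ** ((A - mat b) ** (A - mat c)) = 0"
proof -
  define P where "P = (A - mat a) ** ((A - mat b) ** (A - mat c))"
  have matv: "mat r *v x = r *\<^sub>R x" for r and x :: "real^'n"
    by (simp add: matrix_vector_mult_def mat_def vec_eq_iff if_distrib if_distribR cong: if_cong)
  have Pv: "P *v x = (A - mat a) *v ((A - mat b) *v ((A - mat c) *v x))" for x
    by (simp add: P_def matrix_vector_mul_assoc)
  have shift: "(A - mat r) *v x = A *v x - r *\<^sub>R x" for r x
    by (simp add: matrix_vector_mult_diff_rdistrib matv)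
  note mv = matrix_vector_mult_diff_distrib matrix_vector_mult_scaleR
  have comm: "P *v (A *v x) = A *v (P *v x)" for x
    unfolding Pv shift by (simp add: mv)
  have self: "x \<bullet> (P *v y) = (P *v x) \<bullet> y" for x y
    unfolding Pv shift using symmetric_matrix_inner[OF sym]
    by (simp add: mv inner_diff_left inner_diff_right algebra_simps)
  have "P *v w = 0" for w
  proof (rule ccontr)
    assume ne: "P *v w \<noteq> 0"
    define W where "W = range ((*v) P)"
    have W: "subspace W" unfolding W_def
      by (rule linear_subspace_image) auto
    have inv: "A *v x \<in> W" if "x \<in> W" for x
      using that unfolding W_def by (auto simp flip: comm)
    have "P *v w \<in> W" by (simp add: W_def)
    from rayleigh_maximum[OF sym W inv this ne] obtain x l where
      x: "x \<in> W" "x \<noteq> 0" "A *v x = l *\<^sub>R x" by blast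
    obtain y where y: "x = P *v y" using x(1) by (auto simp: W_def)
    have "P *v x = ((l - a) * (l - b) * (l - c)) *\<^sub>R x"
      unfolding Pv shift by (simp add: mv x(3) algebra_simps)
    also have "\<dots> = 0" using eig[OF x(2,3)] by auto
    finally have "x \<bullet> x = 0" using self[of x y] y by simp
    then show False using x(2) by simp
  qed
  then show ?thesis unfolding P_def[symmetric]
    by (simp add: matrix_eq)
qed



section \<open>Graphs with three eigenvalues\<close>

lemma adjacency_real_symmetric:
  assumes "simple_graph E"
  shows "transpose ((\<chi> u v. of_bool (E u v)) :: real^'v^'v) = (\<chi> u v. of_bool (E u v))"
  using assms by (auto simp: simple_graph_def transpose_def vec_eq_iff symp_def)

text \<open>
  A complex eigenvector of a real symmetric matrix splits into two real vectors, one of which is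
  an eigenvector for the same, necessarily real, eigenvalue.
\<close>

lemma complex_eigenvalues_adjacency:
  fixes E :: "'v::finite \<Rightarrow> 'v \<Rightarrow> bool"
  assumes "simple_graph E"
  shows "eigenvalues (adjacency_matrix E) =
    of_real ` {l. \<exists>x :: real^'v. x \<noteq> 0 \<and> (\<chi> u v. of_bool (E u v)) *v x = l *\<^sub>R x}"
proof -
  define A :: "real^'v^'v" where "A = (\<chi> u v. of_bool (E u v))"
  have sym: "transpose A = A" unfolding A_def by (rule adjacency_real_symmetric[OF assms])
  have Anth: "(A *v x) $ u = (\<Sum>v\<in>UNIV. of_bool (E u v) * x $ v)" for x u
    by (simp add: A_def matrix_vector_mult_def)
  have Cnth: "(adjacency_matrix E *v z) $ u = (\<Sum>v\<in>UNIV. of_bool (E u v) * z $ v)" for z u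
    by (simp add: adjacency_matrix_def matrix_vector_mult_def)
  have "c \<in> of_real ` {l. \<exists>x. x \<noteq> 0 \<and> A *v x = l *\<^sub>R x}"
    if ev: "c \<in> eigenvalues (adjacency_matrix E)" for c
  proof -
    obtain z where z: "z \<noteq> 0" "adjacency_matrix E *v z = c *s z"
      using ev unfolding eigenvalues_def by blast
    define x where "x = (\<chi> u. Re (z $ u))"
    define y where "y = (\<chi> u. Im (z $ u))"
    have zu: "(\<Sum>v\<in>UNIV. of_bool (E u v) * z $ v) = c * z $ u" for u
      using arg_cong[OF z(2), of "\<lambda>w. w $ u"] by (simp add: Cnth)
    have Ax: "A *v x = Re c *\<^sub>R x - Im c *\<^sub>R y"
      using arg_cong[OF zu, of Re] by (simp add: vec_eq_iff Anth x_def y_def)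
    have Ay: "A *v y = Im c *\<^sub>R x + Re c *\<^sub>R y"
      using arg_cong[OF zu, of Im] by (simp add: vec_eq_iff Anth x_def y_def)
    have xy: "x \<noteq> 0 \<or> y \<noteq> 0"
      using z(1) by (auto simp: vec_eq_iff x_def y_def complex_eq_iff)
    have "Im c * (x \<bullet> x + y \<bullet> y) = 0"
      using symmetric_matrix_inner[OF sym, of x y]
      by (simp add: Ax Ay inner_add_right inner_diff_left algebra_simps inner_commute)
    moreover have "x \<bullet> x + y \<bullet> y \<noteq> 0"
      using xy by (metis add_nonneg_eq_0_iff inner_eq_zero_iff inner_ge_zero)
    ultimately have im: "Im c = 0" by simp
    then have c: "c = of_real (Re c)" by (simp add: complex_eq_iff)
    have "\<exists>x. x \<noteq> 0 \<and> A *v x = Re c *\<^sub>R x" using xy Ax Ay im by auto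
    then show ?thesis using c by blast
  qed
  moreover have "of_real l \<in> eigenvalues (adjacency_matrix E)"
    if x: "x \<noteq> 0" "A *v x = l *\<^sub>R x" for l x
  proof -
    define z :: "complex^'v" where "z = (\<chi> u. of_real (x $ u))"
    have "z \<noteq> 0" using x(1) by (auto simp: z_def vec_eq_iff)
    moreover have "adjacency_matrix E *v z = of_real l *s z"
    proof -
      have "(adjacency_matrix E *v z) $ u = of_real ((A *v x) $ u)" for u
        by (simp add: Cnth Anth z_def)
      then show ?thesis by (simp add: vec_eq_iff x(2) z_def)
    qed
    ultimately show ?thesis by (auto simp: eigenvalues_def)
  qed
  ultimately show ?thesis unfolding A_def by blast
qed

text \<open>
  Passing from an eigenvector for the largest eigenvalue to its absolute values does not decrease the
  Rayleigh quotient, so the absolute values form an eigenvector as well. Zeros of it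
  propagate along edges, so by connectedness no eigenvector for this eigenvalue vanishes anywhere.
\<close>

lemma perron_eigenvector:
  fixes E :: "'v::finite \<Rightarrow> 'v \<Rightarrow> bool"
  assumes E: "simple_graph E" "connected_graph E"
  defines "A \<equiv> ((\<chi> u v. of_bool (E u v)) :: real^'v^'v)"
  shows "\<exists>l x. A *v x = l *\<^sub>R x \<and> (\<forall>u. 0 < x $ u) \<and>
    (\<forall>y. A *v y = l *\<^sub>R y \<longrightarrow> (\<exists>t. y = t *\<^sub>R x)) \<and>
    (\<forall>y r. y \<noteq> 0 \<longrightarrow> A *v y = r *\<^sub>R y \<longrightarrow> r \<le> l)"
proof -
  have sym: "transpose A = A" unfolding A_def by (rule adjacency_real_symmetric[OF E(1)])
  have Anth: "(A *v x) $ u = (\<Sum>v\<in>UNIV. of_bool (E u v) * x $ v)" for x u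
    by (simp add: A_def matrix_vector_mult_def)
  have "(1 :: real^'v) \<noteq> 0" by simp
  from rayleigh_maximum[OF sym subspace_UNIV UNIV_I UNIV_I this] obtain x0 l where
    x0: "x0 \<noteq> 0" "A *v x0 = l *\<^sub>R x0" and bound: "\<And>y. y \<bullet> (A *v y) \<le> l * (y \<bullet> y)"
    by (metis UNIV_I)
  define ab where "ab y = (\<chi> u. \<bar>y $ u\<bar>)" for y :: "real^'v"
  have abs_eig: "A *v ab y = l *\<^sub>R ab y" if y: "A *v y = l *\<^sub>R y" for y
  proof (rule rayleigh_equality_eigenvector[OF sym subspace_UNIV UNIV_I bound UNIV_I])
    have n: "ab y \<bullet> ab y = y \<bullet> y" by (simp add: ab_def inner_vec_def)
    have "y \<bullet> (A *v y) \<le> ab y \<bullet> (A *v ab y)"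
      unfolding inner_vec_def Anth ab_def
      by (auto simp: sum_distrib_left abs_mult intro!: sum_mono)
        (metis abs_ge_self abs_mult)
    then show "ab y \<bullet> (A *v ab y) = l * (ab y \<bullet> ab y)"
      using bound[of "ab y"] n y by simp
  qed
  have nowhere: "y = 0" if y: "A *v y = l *\<^sub>R y" and u: "y $ u = 0" for y u
  proof -
    have step: "y $ w = 0" if "E v w" "y $ v = 0" for v w
    proof -
      have "(\<Sum>w\<in>UNIV. of_bool (E v w) * \<bar>y $ w\<bar>) = 0"
        using arg_cong[OF abs_eig[OF y], of "\<lambda>z. z $ v"] that(2) by (simp add: Anth ab_def)
      then have "of_bool (E v w) * \<bar>y $ w\<bar> = 0"
        by (subst (asm) sum_nonneg_eq_0_iff) auto
      then show ?thesis using that(1) by simp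
    qed
    have "y $ w = 0" for w
    proof -
      have "E\<^sup>*\<^sup>* u w" using E(2) by (simp add: connected_graph_def)
      then show ?thesis by (induction) (use u step in auto)
    qed
    then show ?thesis by (simp add: vec_eq_iff)
  qed
  define x where "x = ab x0"
  have x: "A *v x = l *\<^sub>R x" unfolding x_def by (rule abs_eig[OF x0(2)])
  have pos: "0 < x $ u" for u
    using nowhere[OF x0(2), of u] x0(1) by (auto simp: x_def ab_def)
  have "\<exists>t. y = t *\<^sub>R x" if y: "A *v y = l *\<^sub>R y" for y
  proof -
    fix u :: 'v
    define t where "t = y $ u / x $ u"
    have "A *v (y - t *\<^sub>R x) = l *\<^sub>R (y - t *\<^sub>R x)"
      using x y by (simp add: matrix_vector_mult_diff_distrib matrix_vector_mult_scaleR algebra_simps)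
    moreover have "(y - t *\<^sub>R x) $ u = 0" using pos[of u] by (simp add: t_def)
    ultimately show ?thesis using nowhere by (metis eq_iff_diff_eq_0)
  qed
  moreover have "r \<le> l" if y: "y \<noteq> 0" "A *v y = r *\<^sub>R y" for y r
    using bound[of y] y by (simp add: mult_le_cancel_right)
  ultimately show ?thesis using x pos by blast
qed

text \<open>
  The left-hand side is the number of walks of length two from \<open>u\<close> to \<open>w\<close>, that is, an entry of the
  square of the adjacency matrix.
\<close>

theorem three_eigenvalue_walk_count:
  fixes E :: "'v::finite \<Rightarrow> 'v \<Rightarrow> bool"
  assumes "E \<in> three_eigenvalue_graphs"
  shows "\<exists>(s::real) p \<alpha>. (\<forall>u. 0 < \<alpha> u) \<and>
    (\<forall>u w. (\<Sum>z\<in>UNIV. of_bool (E u z) * of_bool (E z w)) =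
      s * of_bool (E u w) - p * of_bool (u = w) + \<alpha> u * \<alpha> w)"
proof -
  have E: "simple_graph E" "connected_graph E" "card (eigenvalues (adjacency_matrix E)) = 3"
    using assms by (auto simp: three_eigenvalue_graphs_def)
  define A :: "real^'v^'v" where "A = (\<chi> u v. of_bool (E u v))"
  have sym: "transpose A = A" unfolding A_def by (rule adjacency_real_symmetric[OF E(1)])
  define R where "R = {l. \<exists>x. x \<noteq> 0 \<and> A *v x = l *\<^sub>R x}"
  have R: "card R = 3"
    using E(3) unfolding complex_eigenvalues_adjacency[OF E(1)] R_def A_def
    by (subst (asm) card_image) (auto intro: inj_onI)
  obtain l x where x: "A *v x = l *\<^sub>R x" "\<And>u. 0 < x $ u"
    and simple: "\<And>y. A *v y = l *\<^sub>R y \<Longrightarrow> \<exists>t. y = t *\<^sub>R x"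
    and top: "\<And>y r. y \<noteq> 0 \<Longrightarrow> A *v y = r *\<^sub>R y \<Longrightarrow> r \<le> l"
    using perron_eigenvector[OF E(1,2)] unfolding A_def by metis
  have x0: "x \<noteq> 0" using x(2) by (metis less_irrefl zero_index)
  have lR: "l \<in> R" using x(1) x0 by (auto simp: R_def)
  have "finite R" using R card.infinite by fastforce
  with R lR have "card (R - {l}) = 2" by simp
  then obtain a b where ab: "R - {l} = {a, b}" "a \<noteq> b" by (auto simp: card_2_iff)
  then have Req: "R = {l, a, b}" and "a \<in> R" "b \<in> R" "a \<noteq> l" "b \<noteq> l" using lR by auto
  then have less: "a < l" "b < l" using top unfolding R_def by (force simp: less_le)+
  define M where "M = (A - mat a) ** (A - mat b)"
  have matv: "mat r *v y = r *\<^sub>R y" for r and y :: "real^'v"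
    by (simp add: matrix_vector_mult_def mat_def vec_eq_iff if_distrib if_distribR cong: if_cong)
  have shift: "(A - mat r) *v y = A *v y - r *\<^sub>R y" for r y
    by (simp add: matrix_vector_mult_diff_rdistrib matv)
  note mv = matrix_vector_mult_diff_distrib matrix_vector_mult_scaleR
  have Mv: "M *v y = (A - mat a) *v ((A - mat b) *v y)" for y
    by (simp add: M_def matrix_vector_mul_assoc)
  have Mself: "y \<bullet> (M *v z) = (M *v y) \<bullet> z" for y z
    unfolding Mv shift using symmetric_matrix_inner[OF sym]
    by (simp add: mv inner_diff_left inner_diff_right algebra_simps)
  \<comment> \<open>All columns of \<open>M\<close> are multiples of \<open>x\<close>, and \<open>M\<close> is symmetric; hence it is a multiple of \<open>x x\<^sup>T\<close>.
    The factor is positive because both other eigenvalues are smaller than \<open>l\<close>.\<close>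
  have "(A - mat l) ** M = 0"
    unfolding M_def
    by (rule symmetric_matrix_annihilated[OF sym]) (use Req in \<open>auto simp: R_def\<close>)
  then have "(A - mat l) *v (M *v y) = 0" for y
    by (simp add: matrix_vector_mul_assoc)
  then have "A *v (M *v y) = l *\<^sub>R (M *v y)" for y by (simp add: shift)
  then have "\<exists>t. M *v y = t *\<^sub>R x" for y using simple by blast
  then obtain t where t: "\<And>y. M *v y = t y *\<^sub>R x" by metis
  define k where "k = (l - a) * (l - b) / (x \<bullet> x)"
  have kpos: "k > 0" using less x0 by (simp add: k_def)
  have Mx: "M *v x = ((l - a) * (l - b)) *\<^sub>R x"
    unfolding Mv shift by (simp add: mv x(1) algebra_simps)
  have t_eq: "t y = k * (x \<bullet> y)" for y
  proof -
    have "t y * (x \<bullet> x) = x \<bullet> (M *v y)" by (simp add: t)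
    also have "\<dots> = (l - a) * (l - b) * (x \<bullet> y)" unfolding Mself by (simp add: Mx)
    finally show ?thesis using x0 by (simp add: k_def field_simps)
  qed
  define \<alpha> where "\<alpha> u = sqrt k * x $ u" for u
  have pos: "0 < \<alpha> u" for u using kpos x(2) by (simp add: \<alpha>_def)
  have "(\<Sum>z\<in>UNIV. of_bool (E u z) * of_bool (E z w)) =
      (a + b) * of_bool (E u w) - (a * b) * of_bool (u = w) + \<alpha> u * \<alpha> w" for u w
  proof -
    have Aw: "A *v axis w 1 = (\<chi> u. of_bool (E u w))"
      by (simp add: matrix_vector_mult_basis column_def A_def)
    have "(A *v (A *v axis w 1)) $ u = (\<Sum>z\<in>UNIV. of_bool (E u z) * of_bool (E z w))"
      unfolding Aw by (simp add: A_def matrix_vector_mult_def)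
    moreover have "(M *v axis w 1) $ u = (A *v (A *v axis w 1)) $ u
        - (a + b) * of_bool (E u w) + (a * b) * of_bool (u = w)"
      unfolding Mv shift by (simp add: mv Aw) (simp add: axis_def algebra_simps)
    moreover have "(M *v axis w 1) $ u = \<alpha> u * \<alpha> w"
      using kpos by (simp add: t t_eq \<alpha>_def inner_axis)
    ultimately show ?thesis by linarith
  qed
  then show ?thesis using pos by blast
qed


section \<open>Joins of blocks and their coherent algebra\<close>

text \<open>
  Given a colouring \<open>f\<close> of the vertices, these are the matrices that are constant on each
  off-diagonal block of the induced partition, and that on each diagonal block are a combination
  of \<open>J\<close>, \<open>I\<close> and the adjacency matrix of the block.
\<close>

definition block_algebra :: "('v::finite \<Rightarrow> 'v \<Rightarrow> bool) \<Rightarrow> ('v \<Rightarrow> 'b) \<Rightarrow> (complex^'v^'v) set" where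
  "block_algebra E f = {M. \<exists>a b e. \<forall>u v. M $ u $ v = a (f u) (f v) + b (f u) * of_bool (u = v)
     + e (f u) * of_bool (f u = f v \<and> E u v)}"

lemma of_real_of_bool: "of_real (of_bool b) = of_bool b"
  by simp

text \<open>
  A join of the blocks of a colouring \<open>f\<close>, with the formula for the number of walks of length two
  known for graphs with three eigenvalues, in which the weights depend only on the block. The
  parameter \<open>\<beta>\<close> gives the weight of a block.
\<close>

locale walk_regular_join =
  fixes E :: "'v::finite \<Rightarrow> 'v \<Rightarrow> bool" and f :: "'v \<Rightarrow> 'b" and s p :: real and \<beta> :: "'b \<Rightarrow> real"
  assumes sym: "E u v \<longleftrightarrow> E v u" and irrefl: "\<not> E u u"
    and join: "f u \<noteq> f v \<Longrightarrow> E u v"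
    and walks: "(\<Sum>z\<in>UNIV. of_bool (E u z) * of_bool (E z w)) =
      s * of_bool (E u w) - p * of_bool (u = w) + \<beta> (f u) * \<beta> (f w)"
begin

(* Sums of truth values are to stay sums, not to become cardinalities. *)
declare sum_of_bool_eq [simp del] sum_mult_of_bool_eq [simp del] sum_of_bool_mult_eq [simp del]

text \<open>The number of vertices outside a block.\<close>

definition outside :: "'b \<Rightarrow> real" where
  "outside c = (\<Sum>z\<in>UNIV. of_bool (f z \<noteq> c))"

text \<open>
  The common degree of the vertices of block \<open>c\<close> in the graph induced on it
  (\<open>within_degree\<close>): the total degree is \<open>(\<beta> c)\<^sup>2 - p\<close>, and all vertices outside are adjacent.
\<close>

definition valency :: "'b \<Rightarrow> real" where
  "valency c = (\<beta> c)\<^sup>2 - p - outside c"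

text \<open>Adjacency within a block.\<close>

abbreviation block_adj :: "'v \<Rightarrow> 'v \<Rightarrow> bool" where
  "block_adj u v \<equiv> f u = f v \<and> E u v"

text \<open>
  Between two vertices of the same block, all vertices outside the block give walks of length two;
  the remaining walks stay within the block.
\<close>

lemma within_walks:
  "(\<Sum>z\<in>UNIV. of_bool (block_adj u z) * of_bool (block_adj z w)) =
    of_bool (f u = f w) * (valency (f u) + p - p * of_bool (u = w) + s * of_bool (block_adj u w))"
proof (cases "f u = f w")
  case True
  have "(\<Sum>z\<in>UNIV. of_bool (E u z) * of_bool (E z w)) =
    (\<Sum>z\<in>UNIV. of_bool (block_adj u z) * of_bool (block_adj z w) + (of_bool (f z \<noteq> f u) :: real))"
    using True by (intro sum.cong refl) (use join in \<open>auto simp: of_bool_def\<close>)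
  also have "\<dots> = (\<Sum>z\<in>UNIV. of_bool (block_adj u z) * of_bool (block_adj z w)) + outside (f u)"
    by (simp add: sum.distrib outside_def)
  finally show ?thesis using True walks[of u w]
    by (simp add: valency_def power2_eq_square)
next
  case False
  then have zero: "of_bool (block_adj u z) * of_bool (block_adj z w) = (0::real)" for z by auto
  show ?thesis using False by (simp only: zero) simp
qed

lemma within_degree: "(\<Sum>z\<in>UNIV. of_bool (block_adj u z)) = valency (f u)"
proof -
  have "(\<Sum>z\<in>UNIV. of_bool (block_adj u z)) =
    (\<Sum>z\<in>UNIV. of_bool (block_adj u z) * of_bool (block_adj z u) :: real)"
    using sym by (intro sum.cong) auto
  then show ?thesis using irrefl[of u] by (simp add: within_walks)
qed

lemma within_walks_complex:
  "(\<Sum>z\<in>UNIV. of_bool (block_adj u z) * of_bool (block_adj z w) :: complex) =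
    of_bool (f u = f w) * of_real (valency (f u) + p) - of_real p * of_bool (u = w) +
    of_real s * of_bool (block_adj u w)"
proof -
  have "(\<Sum>z\<in>UNIV. of_bool (block_adj u z) * of_bool (block_adj z w) :: complex) =
     of_real (\<Sum>z\<in>UNIV. of_bool (block_adj u z) * of_bool (block_adj z w))"
    by (simp only: of_real_sum of_real_mult of_real_of_bool)
  then show ?thesis unfolding within_walks by auto
qed

lemma within_degree_complex:
  "(\<Sum>z\<in>UNIV. of_bool (block_adj u z) :: complex) = of_real (valency (f u))"
  "(\<Sum>z\<in>UNIV. of_bool (block_adj z u) :: complex) = of_real (valency (f u))"
proof -
  have "(\<Sum>z\<in>UNIV. of_bool (block_adj u z) :: complex) = of_real (\<Sum>z\<in>UNIV. of_bool (block_adj u z))"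
    by (simp only: of_real_sum of_real_of_bool)
  then show 1: "(\<Sum>z\<in>UNIV. of_bool (block_adj u z) :: complex) = of_real (valency (f u))"
    by (simp only: within_degree)
  show "(\<Sum>z\<in>UNIV. of_bool (block_adj z u) :: complex) = of_real (valency (f u))"
    unfolding 1[symmetric] using sym by (intro sum.cong) auto
qed

lemma block_algebraI:
  assumes "\<And>u v. M $ u $ v = a (f u) (f v) + b (f u) * of_bool (u = v) + e (f u) * of_bool (block_adj u v)"
  shows "M \<in> block_algebra E f"
  unfolding block_algebra_def using assms by blast

lemma block_algebra_mult:
  assumes "M \<in> block_algebra E f" "N \<in> block_algebra E f"
  shows "M ** N \<in> block_algebra E f"
proof -
  obtain a b e where M: "\<And>u v. M $ u $ v =
      a (f u) (f v) + b (f u) * of_bool (u = v) + e (f u) * of_bool (block_adj u v)"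
    using assms(1) unfolding block_algebra_def by blast
  obtain a' b' e' where N: "\<And>u v. N $ u $ v =
      a' (f u) (f v) + b' (f u) * of_bool (u = v) + e' (f u) * of_bool (block_adj u v)"
    using assms(2) unfolding block_algebra_def by blast
  \<comment> \<open>The coefficients \<open>b'\<close> and \<open>e'\<close> matter only where both colours agree, so they may be taken at
    the right end, independently of the summation index in the product.\<close>
  have N': "N $ u $ v =
      a' (f u) (f v) + b' (f v) * of_bool (u = v) + e' (f v) * of_bool (block_adj u v)" for u v
    unfolding N by auto
  define a'' where "a'' c d = (\<Sum>z\<in>UNIV. a c (f z) * a' (f z) d) + a c d * b' d
     + a c d * e' d * of_real (valency d) + b c * a' c d + e c * of_real (valency c) * a' c d
     + of_bool (c = d) * e c * e' c * of_real (valency c + p)" for c d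
  show ?thesis
  proof (rule block_algebraI)
    fix u w
    have delta: "(\<Sum>z\<in>UNIV. g z * of_bool (z = w)) = g w" for w and g :: "'v \<Rightarrow> complex"
    proof -
      have "g z * of_bool (z = w) = (if z = w then g z else 0)" for z by simp
      then show ?thesis by (simp only: sum.delta finite) simp
    qed
    have t1: "(\<Sum>z\<in>UNIV. a (f u) (f z) * (b' (f w) * of_bool (z = w))) = a (f u) (f w) * b' (f w)"
      using delta[of "\<lambda>z. a (f u) (f z) * b' (f w)" w] by (simp only: mult_ac)
    have t2: "(\<Sum>z\<in>UNIV. a (f u) (f z) * (e' (f w) * of_bool (block_adj z w))) =
        a (f u) (f w) * e' (f w) * of_real (valency (f w))"
    proof -
      have "(\<Sum>z\<in>UNIV. a (f u) (f z) * (e' (f w) * of_bool (block_adj z w))) =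
        (\<Sum>z\<in>UNIV. a (f u) (f w) * e' (f w) * of_bool (block_adj z w))"
        by (intro sum.cong) auto
      then show ?thesis by (simp only: within_degree_complex flip: sum_distrib_left)
    qed
    have t3: "(\<Sum>z\<in>UNIV. b (f u) * of_bool (u = z) * g z) = b (f u) * g u" for g
      using delta[of "\<lambda>z. b (f u) * g z" u] by (simp only: mult_ac eq_commute[of u])
    have t4: "(\<Sum>z\<in>UNIV. e (f u) * of_bool (block_adj u z) * a' (f z) (f w)) =
        e (f u) * of_real (valency (f u)) * a' (f u) (f w)"
    proof -
      have "(\<Sum>z\<in>UNIV. e (f u) * of_bool (block_adj u z) * a' (f z) (f w)) =
        (\<Sum>z\<in>UNIV. e (f u) * a' (f u) (f w) * of_bool (block_adj u z))"
        by (intro sum.cong) auto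
      then show ?thesis by (simp only: within_degree_complex mult_ac flip: sum_distrib_left)
    qed
    have t5: "(\<Sum>z\<in>UNIV. e (f u) * of_bool (block_adj u z) * (b' (f w) * of_bool (z = w))) =
        e (f u) * b' (f w) * of_bool (block_adj u w)"
      using delta[of "\<lambda>z. e (f u) * of_bool (block_adj u z) * b' (f w)" w] by (simp only: mult_ac)
    have t6: "(\<Sum>z\<in>UNIV. e (f u) * of_bool (block_adj u z) * (e' (f w) * of_bool (block_adj z w))) =
        e (f u) * e' (f w) * (of_bool (f u = f w) * of_real (valency (f u) + p)
          - of_real p * of_bool (u = w) + of_real s * of_bool (block_adj u w))"
      unfolding within_walks_complex[symmetric] sum_distrib_left
      by (intro sum.cong refl) (simp only: mult_ac)
    have "(M ** N) $ u $ w = (\<Sum>z\<in>UNIV. M $ u $ z * N $ z $ w)"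
      by (simp add: matrix_matrix_mult_def)
    also have "\<dots> = (\<Sum>z\<in>UNIV. a (f u) (f z) * a' (f z) (f w))
        + a (f u) (f w) * b' (f w) + a (f u) (f w) * e' (f w) * of_real (valency (f w))
        + b (f u) * (a' (f u) (f w) + b' (f w) * of_bool (u = w) + e' (f w) * of_bool (block_adj u w))
        + e (f u) * of_real (valency (f u)) * a' (f u) (f w)
        + e (f u) * b' (f w) * of_bool (block_adj u w)
        + e (f u) * e' (f w) * (of_bool (f u = f w) * of_real (valency (f u) + p)
          - of_real p * of_bool (u = w) + of_real s * of_bool (block_adj u w))"
      unfolding M N' distrib_right
      unfolding t3 sum.distrib
      unfolding distrib_left sum.distrib t1 t2 t4 t5 t6
      by (simp only: add_ac)
    also have "\<dots> = a'' (f u) (f w)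
        + (b (f u) * b' (f u) - of_real p * e (f u) * e' (f u)) * of_bool (u = w)
        + (b (f u) * e' (f u) + e (f u) * b' (f u) + of_real s * e (f u) * e' (f u))
          * of_bool (block_adj u w)"
      by (cases "f u = f w"; cases "u = w") (auto simp: a''_def algebra_simps)
    finally show "(M ** N) $ u $ w = a'' (f u) (f w)
        + (b (f u) * b' (f u) - of_real p * e (f u) * e' (f u)) * of_bool (u = w)
        + (b (f u) * e' (f u) + e (f u) * b' (f u) + of_real s * e (f u) * e' (f u))
          * of_bool (block_adj u w)" .
  qed
qed

lemma coherent_block_algebra: "coherent_algebra (block_algebra E f)"
  unfolding coherent_algebra_def
proof (intro conjI ballI)
  show "cmat.subspace (block_algebra E f)"
  proof (rule cmat.subspaceI)
    show "0 \<in> block_algebra E f"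
      by (rule block_algebraI[where a = "\<lambda>_ _. 0" and b = "\<lambda>_. 0" and e = "\<lambda>_. 0"]) simp
  next
    fix M N assume MN: "M \<in> block_algebra E f" "N \<in> block_algebra E f"
    obtain a b e where M: "\<And>u v. M $ u $ v =
        a (f u) (f v) + b (f u) * of_bool (u = v) + e (f u) * of_bool (block_adj u v)"
      using MN(1) unfolding block_algebra_def by blast
    obtain a' b' e' where N: "\<And>u v. N $ u $ v =
        a' (f u) (f v) + b' (f u) * of_bool (u = v) + e' (f u) * of_bool (block_adj u v)"
      using MN(2) unfolding block_algebra_def by blast
    show "M + N \<in> block_algebra E f"
      by (rule block_algebraI[where a = "\<lambda>c d. a c d + a' c d" and b = "\<lambda>c. b c + b' c"
          and e = "\<lambda>c. e c + e' c"]) (simp add: M N algebra_simps)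
  next
    fix k M assume "M \<in> block_algebra E f"
    then obtain a b e where M: "\<And>u v. M $ u $ v =
        a (f u) (f v) + b (f u) * of_bool (u = v) + e (f u) * of_bool (block_adj u v)"
      unfolding block_algebra_def by blast
    show "scale_matrix k M \<in> block_algebra E f"
      by (rule block_algebraI[where a = "\<lambda>c d. k * a c d" and b = "\<lambda>c. k * b c"
          and e = "\<lambda>c. k * e c"]) (simp add: M scale_matrix_def algebra_simps)
  qed
  show "mat 1 \<in> block_algebra E f"
    by (rule block_algebraI[where a = "\<lambda>_ _. 0" and b = "\<lambda>_. 1" and e = "\<lambda>_. 0"])
      (simp add: mat_def)
  show "all_ones \<in> block_algebra E f"
    by (rule block_algebraI[where a = "\<lambda>_ _. 1" and b = "\<lambda>_. 0" and e = "\<lambda>_. 0"])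
      (simp add: all_ones_def)
next
  fix M assume "M \<in> block_algebra E f"
  then obtain a b e where M: "\<And>u v. M $ u $ v =
      a (f u) (f v) + b (f u) * of_bool (u = v) + e (f u) * of_bool (block_adj u v)"
    unfolding block_algebra_def by blast
  show "transpose M \<in> block_algebra E f"
  proof (rule block_algebraI[where a = "\<lambda>c d. a d c" and b = b and e = e])
    fix u v
    show "transpose M $ u $ v =
      a (f v) (f u) + b (f u) * of_bool (u = v) + e (f u) * of_bool (block_adj u v)"
      using sym[of u v] by (auto simp: M transpose_def)
  qed
next
  fix M N assume MN: "M \<in> block_algebra E f" "N \<in> block_algebra E f"
  then show "M ** N \<in> block_algebra E f" by (rule block_algebra_mult)
  obtain a b e where M: "\<And>u v. M $ u $ v =
      a (f u) (f v) + b (f u) * of_bool (u = v) + e (f u) * of_bool (block_adj u v)"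
    using MN(1) unfolding block_algebra_def by blast
  obtain a' b' e' where N: "\<And>u v. N $ u $ v =
      a' (f u) (f v) + b' (f u) * of_bool (u = v) + e' (f u) * of_bool (block_adj u v)"
    using MN(2) unfolding block_algebra_def by blast
  show "entrywise_mult M N \<in> block_algebra E f"
    by (rule block_algebraI[where a = "\<lambda>c d. a c d * a' c d"
          and b = "\<lambda>c. a c c * b' c + b c * a' c c + b c * b' c"
          and e = "\<lambda>c. a c c * e' c + e c * a' c c + e c * e' c"])
      (auto simp: M N entrywise_mult_def of_bool_def irrefl algebra_simps)
qed

lemma adjacency_matrix_in_block_algebra: "adjacency_matrix E \<in> block_algebra E f"
  by (rule block_algebraI[where a = "\<lambda>c d. of_bool (c \<noteq> d)" and b = "\<lambda>_. 0" and e = "\<lambda>_. 1"])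
    (use join in \<open>auto simp: adjacency_matrix_def\<close>)

text \<open>
  The entries of matrices in the coherent closure depend only on the blocks of the two vertices, on
  their equality and on their adjacency.
\<close>

lemma coherent_closure_entry_cong:
  assumes "M \<in> coherent_closure E" "f u = f x" "f v = f y" "u = v \<longleftrightarrow> x = y" "E u v \<longleftrightarrow> E x y"
  shows "M $ u $ v = M $ x $ y"
proof -
  have "M \<in> block_algebra E f"
    using coherent_closure_least[OF coherent_block_algebra adjacency_matrix_in_block_algebra] assms(1)
    by blast
  then show ?thesis using assms unfolding block_algebra_def by auto
qed

text \<open>
  In the join of two blocks, of which one has an edge and the other is complete or empty on at least
  two vertices, the two weights, if positive, agree. The equations come from counting walks of
  length two between the blocks, those between two vertices \<open>x\<close>, \<open>y\<close> of the trivial block \<open>d\<close>, and,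
  if that block is empty, those within \<open>c\<close> from a vertex of \<open>c\<close>.
\<close>

lemma weights_eq:
  assumes pos: "\<beta> c > 0" "\<beta> d > 0"
    and blocks: "\<And>u. f u = c \<or> f u = d" "c \<noteq> d"
    and edge: "f u = c" "f v = c" "E u v"
    and two: "f x = d" "f y = d" "x \<noteq> y"
    and trivial: "(\<forall>x y. f x = d \<longrightarrow> f y = d \<longrightarrow> \<not> E x y) \<or>
      (\<forall>x y. f x = d \<longrightarrow> f y = d \<longrightarrow> x \<noteq> y \<longrightarrow> E x y)"
  shows "\<beta> c = \<beta> d"
proof -
  have ind: "f z \<noteq> c \<longleftrightarrow> f z = d" "f z \<noteq> d \<longleftrightarrow> f z = c" for z
    using blocks by metis+
  have out_c: "outside c = (\<Sum>z\<in>UNIV. of_bool (f z = d))"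
    and out_d: "outside d = (\<Sum>z\<in>UNIV. of_bool (f z = c))"
    by (simp_all only: outside_def ind)
  have cross: "valency c + valency d = s + \<beta> c * \<beta> d"
  proof -
    have "(\<Sum>z\<in>UNIV. of_bool (E u z) * of_bool (E z x)) =
        (\<Sum>z\<in>UNIV. of_bool (block_adj u z) + (of_bool (block_adj x z) :: real))"
    proof (intro sum.cong refl)
      fix z show "of_bool (E u z) * of_bool (E z x) =
        of_bool (block_adj u z) + (of_bool (block_adj x z) :: real)"
      proof (cases "f z = c")
        case True
        then show ?thesis using blocks(2) edge(1) two(1) join[of z x] by simp
      next
        case False
        then show ?thesis using blocks(1)[of z] edge(1) two(1) join[of u z] sym[of x z] by simp
      qed
    qed
    moreover have "E u x" "u \<noteq> x" using join[of u x] blocks(2) edge(1) two(1) by auto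
    ultimately show ?thesis
      using walks[of u x] within_degree[of u] within_degree[of x] edge(1) two(1)
      by (simp add: sum.distrib)
  qed
  from trivial show ?thesis
  proof
    assume empty: "\<forall>x y. f x = d \<longrightarrow> f y = d \<longrightarrow> \<not> E x y"
    then have none: "block_adj x z \<longleftrightarrow> False" for z using two(1) by metis
    have vd: "valency d = 0" using within_degree[of x] two(1) unfolding none by simp
    have "valency d + p = 0"
      using within_walks[of x y] two unfolding none by simp
    then have p: "p = 0" using vd by simp
    have "valency c \<noteq> 0"
    proof -
      have "0 < (\<Sum>z\<in>UNIV. (of_bool (block_adj u z) :: real))"
        using edge by (intro sum_pos2[of _ v]) auto
      then show ?thesis using within_degree[of u] edge(1) by simp
    qed
    \<comment> \<open>Both sides count the walks of length two from \<open>u\<close> inside \<open>c\<close>.\<close>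
    moreover have "valency c * valency c = s * valency c + valency c * outside d"
    proof -
      have "(\<Sum>w\<in>UNIV. \<Sum>z\<in>UNIV. of_bool (block_adj u z) * of_bool (block_adj z w)) =
          (\<Sum>z\<in>UNIV. of_bool (block_adj u z) * (\<Sum>w\<in>UNIV. (of_bool (block_adj z w) :: real)))"
        by (subst sum.swap) (simp only: sum_distrib_left)
      also have "\<dots> = (\<Sum>z\<in>UNIV. of_bool (block_adj u z) * valency c)"
        unfolding within_degree using edge(1) by (intro sum.cong) auto
      also have "\<dots> = valency c * valency c"
        using within_degree[of u] edge(1) by (simp flip: sum_distrib_right)
      finally have "valency c * valency c =
          (\<Sum>w\<in>UNIV. of_bool (f u = f w) * (valency c + s * of_bool (block_adj u w)))"
        unfolding within_walks p using edge(1) by simp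
      also have "\<dots> = (\<Sum>w\<in>UNIV. of_bool (f w = c) * valency c + s * of_bool (block_adj u w))"
        using edge(1) by (intro sum.cong) auto
      also have "\<dots> = outside d * valency c + s * valency c"
        using within_degree[of u] edge(1)
        by (simp add: sum.distrib out_d flip: sum_distrib_left sum_distrib_right)
      finally show ?thesis by (simp add: algebra_simps)
    qed
    ultimately have "valency c = s + outside d"
      by (metis distrib_left mult.commute mult_cancel_left)
    moreover have "outside d = \<beta> d * \<beta> d"
      using vd p unfolding valency_def[of d] by (simp add: power2_eq_square)
    ultimately have "\<beta> d * \<beta> d = \<beta> c * \<beta> d"
      using cross vd by simp
    then show ?thesis using pos by simp
  next
    assume complete: "\<forall>x y. f x = d \<longrightarrow> f y = d \<longrightarrow> x \<noteq> y \<longrightarrow> E x y"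
    have one: "(\<Sum>z\<in>UNIV. of_bool (z = w) :: real) = 1" for w :: 'v
      by (simp add: sum_of_bool_eq)
    have "(\<Sum>z\<in>UNIV. of_bool (f z = d)) = (\<Sum>z\<in>UNIV. of_bool (block_adj x z) + (of_bool (z = x) :: real))"
      using complete two(1) irrefl by (intro sum.cong) auto
    then have vd: "outside c = valency d + 1"
      using within_degree[of x] two(1) by (simp add: sum.distrib out_c one)
    have "outside c = (\<Sum>z\<in>UNIV. of_bool (block_adj x z) * of_bool (block_adj z y)
        + of_bool (z = x) + (of_bool (z = y) :: real))"
      unfolding out_c
    proof (intro sum.cong refl)
      fix z show "of_bool (f z = d) = of_bool (block_adj x z) * of_bool (block_adj z y)
        + of_bool (z = x) + (of_bool (z = y) :: real)"
        using complete two irrefl by (auto simp: of_bool_def)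
    qed
    then have "outside c = valency d + p + s + 2"
      using complete two within_walks[of x y] by (simp add: sum.distrib one)
    then have "s = - 1 - p" using vd by simp
    then have "\<beta> c * \<beta> c = \<beta> c * \<beta> d"
      using cross vd by (simp add: valency_def[of c] power2_eq_square)
    then show ?thesis using pos by simp
  qed
qed

end


section \<open>Fibres of a coherent algebra\<close>

lemma indicator_class_eq_iff:
  "indicator_class \<A> u v = indicator_class \<A> x y \<longleftrightarrow> (\<forall>M\<in>\<A>. M $ u $ v = M $ x $ y)"
proof
  assume "indicator_class \<A> u v = indicator_class \<A> x y"
  then have "indicator_class \<A> u v $ u $ v = indicator_class \<A> x y $ u $ v" by simp
  then show "\<forall>M\<in>\<A>. M $ u $ v = M $ x $ y"
    by (simp add: indicator_class_def split: if_splits)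
qed (simp add: indicator_class_def)

lemma algebra_rank_eq_card_classes:
  assumes "coherent_algebra \<A>"
  shows "algebra_rank \<A> = card (range (\<lambda>(u, v). indicator_class \<A> u v))"
  unfolding algebra_rank_def
  by (subst the1_equality[OF ex1_standard_basis standard_basis_exists]) (rule assms refl)+

lemma indicator_class_diagonal:
  assumes "coherent_algebra \<A>" "indicator_class \<A> u v = indicator_class \<A> x y"
  shows "u = v \<longleftrightarrow> x = y"
proof -
  have "mat 1 \<in> \<A>" using assms(1) by (simp add: coherent_algebra_def)
  then have "(mat 1 :: complex^_^_) $ u $ v = mat 1 $ x $ y"
    using assms(2) by (simp only: indicator_class_eq_iff)
  then show ?thesis by (simp add: mat_def split: if_splits)
qed

lemma indicator_class_transpose:
  assumes "coherent_algebra \<A>" "indicator_class \<A> u v = indicator_class \<A> x y"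
  shows "indicator_class \<A> v u = indicator_class \<A> y x"
  unfolding indicator_class_eq_iff
proof
  fix M assume "M \<in> \<A>"
  then have "transpose M \<in> \<A>" using assms(1) by (simp add: coherent_algebra_def)
  then have "transpose M $ u $ v = transpose M $ x $ y"
    using assms(2) by (simp only: indicator_class_eq_iff)
  then show "M $ v $ u = M $ y $ x" by (simp add: transpose_def)
qed

text \<open>The class of a diagonal position is the diagonal indicator matrix of a fibre.\<close>

lemma fibre_matrix_nth:
  assumes "coherent_algebra \<A>"
  shows "indicator_class \<A> u u $ x $ y =
    of_bool (x = y \<and> indicator_class \<A> x x = indicator_class \<A> u u)"
proof -
  have "indicator_class \<A> u u $ x $ y = of_bool (indicator_class \<A> x y = indicator_class \<A> u u)"
    unfolding indicator_class_eq_iff by (simp add: indicator_class_def)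
  then show ?thesis using indicator_class_diagonal[OF assms, of x y u u] by auto
qed

lemma fibre_source:
  assumes coh: "coherent_algebra \<A>" and eq: "indicator_class \<A> u v = indicator_class \<A> x y"
  shows "indicator_class \<A> u u = indicator_class \<A> x x"
proof -
  define N where "N = indicator_class \<A> u u ** all_ones"
  have "N \<in> \<A>"
    unfolding N_def using coh indicator_class_in[OF coh] by (auto simp: coherent_algebra_def)
  moreover have "N $ a $ b = of_bool (indicator_class \<A> a a = indicator_class \<A> u u)" for a b
    unfolding N_def matrix_matrix_mult_def fibre_matrix_nth[OF coh]
    by (simp add: all_ones_def)
  moreover have "N $ u $ v = N $ x $ y" if "N \<in> \<A>"
    using eq that by (simp only: indicator_class_eq_iff)
  ultimately show ?thesis by (simp split: if_splits)
qed

lemma fibre_target: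
  assumes coh: "coherent_algebra \<A>" and eq: "indicator_class \<A> u v = indicator_class \<A> x y"
  shows "indicator_class \<A> v v = indicator_class \<A> y y"
  using fibre_source[OF coh indicator_class_transpose[OF coh eq]] .

text \<open>A singleton fibre forms only one class with each other fibre.\<close>

lemma singleton_fibre_class:
  assumes coh: "coherent_algebra \<A>"
    and single: "\<And>z. indicator_class \<A> z z = indicator_class \<A> x x \<Longrightarrow> z = x"
    and y: "indicator_class \<A> y y = indicator_class \<A> y' y'"
  shows "indicator_class \<A> x y = indicator_class \<A> x y'"
  unfolding indicator_class_eq_iff
proof
  fix M assume M: "M \<in> \<A>"
  define N where "N = all_ones ** (indicator_class \<A> x x ** M)"
  have "N \<in> \<A>"
    unfolding N_def using coh M indicator_class_in[OF coh] by (auto simp: coherent_algebra_def)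
  moreover have "N $ w $ w = M $ x $ w" for w
  proof -
    have D: "indicator_class \<A> x x $ z $ t = of_bool (t = x) * of_bool (z = x)" for z t
      unfolding fibre_matrix_nth[OF coh] using single by auto
    have "(indicator_class \<A> x x ** M) $ z $ w = (if z = x then M $ x $ w else 0)" for z
      unfolding matrix_matrix_mult_def by (simp add: D mult.assoc)
    then show ?thesis
      unfolding N_def matrix_matrix_mult_def[of all_ones] by (simp add: all_ones_def)
  qed
  ultimately show "M $ x $ y = M $ x $ y'"
    using y unfolding indicator_class_eq_iff by metis
qed

lemma rank_three_fibres:
  fixes \<A> :: "(complex^'v::finite^'v) set"
  assumes coh: "coherent_algebra \<A>" and S: "card S = 3"
    and inj: "inj_on (\<lambda>u. indicator_class \<A> u u) S"
  shows "9 \<le> algebra_rank \<A>"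
proof -
  have "inj_on (\<lambda>(u, v). indicator_class \<A> u v) (S \<times> S)"
  proof (rule inj_onI, clarsimp)
    fix u v x y assume S: "u \<in> S" "v \<in> S" "x \<in> S" "y \<in> S"
      and eq: "indicator_class \<A> u v = indicator_class \<A> x y"
    show "u = x \<and> v = y"
      using inj_onD[OF inj fibre_source[OF coh eq]] inj_onD[OF inj fibre_target[OF coh eq]] S
      by blast
  qed
  then have "card ((\<lambda>(u, v). indicator_class \<A> u v) ` (S \<times> S)) = 9"
    using S by (simp add: card_image card_cartesian_product)
  then show ?thesis
    unfolding algebra_rank_eq_card_classes[OF coh]
    by (metis card_mono finite finite_imageI image_mono subset_UNIV)
qed

text \<open>
  If the positions from one fibre to another split into several classes, then neither
  fibre is a singleton. So each fibre has at least two classes inside, and there are at least two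
  classes in each of the two directions between the fibres.
\<close>

lemma rank_two_fibres_cross:
  fixes \<A> :: "(complex^'v::finite^'v) set"
  assumes coh: "coherent_algebra \<A>" and rank: "algebra_rank \<A> < 8"
    and x: "indicator_class \<A> x x = indicator_class \<A> x' x'"
    and y: "indicator_class \<A> y y = indicator_class \<A> y' y'"
    and xy: "indicator_class \<A> x x \<noteq> indicator_class \<A> y y"
  shows "indicator_class \<A> x y = indicator_class \<A> x' y'"
proof (rule ccontr)
  assume ne: "indicator_class \<A> x y \<noteq> indicator_class \<A> x' y'"
  define F where "F u = indicator_class \<A> u u" for u
  define C where "C = (\<lambda>(u, v). indicator_class \<A> u v)"
  have F: "F x' = F x" "F y' = F y" "F x \<noteq> F y" using x y xy by (simp_all add: F_def)
  have trans: "indicator_class \<A> y x \<noteq> indicator_class \<A> y' x'"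
    using ne indicator_class_transpose[OF coh] by blast
  have "\<exists>x2. x2 \<noteq> x \<and> F x2 = F x"
  proof (rule ccontr)
    assume no: "\<nexists>x2. x2 \<noteq> x \<and> F x2 = F x"
    then have "x' = x" using F by blast
    then show False using singleton_fibre_class[OF coh, of x y y'] no y ne by (auto simp: F_def)
  qed
  then obtain x2 where x2: "x2 \<noteq> x" "F x2 = F x" by blast
  have "\<exists>y2. y2 \<noteq> y \<and> F y2 = F y"
  proof (rule ccontr)
    assume no: "\<nexists>y2. y2 \<noteq> y \<and> F y2 = F y"
    then have "y' = y" using F by blast
    then show False using singleton_fibre_class[OF coh, of y x x'] no x trans by (auto simp: F_def)
  qed
  then obtain y2 where y2: "y2 \<noteq> y" "F y2 = F y" by blast
  have sep: "C (a, b) \<noteq> C (a', b')"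
    if "F a \<noteq> F a' \<or> F b \<noteq> F b' \<or> (a = b) \<noteq> (a' = b')" for a b a' b'
    using that fibre_source[OF coh, of a b a' b'] fibre_target[OF coh, of a b a' b']
      indicator_class_diagonal[OF coh, of a b a' b'] by (auto simp: C_def F_def)
  have neqs: "x \<noteq> y" "x' \<noteq> y'" using F by auto
  define L where "L = [(x, x), (x, x2), (y, y), (y, y2), (x, y), (x', y'), (y, x), (y', x')]"
  have C: "C (x, y) \<noteq> C (x', y')" "C (y, x) \<noteq> C (y', x')"
    using ne trans by (simp_all add: C_def)
  have "distinct (map C L)"
    using C F F(3)[symmetric] x2 y2 x2(1)[symmetric] y2(1)[symmetric] neqs neqs[symmetric]
    by (simp add: L_def sep)
  then have "card (set (map C L)) = 8" by (simp only: distinct_card) (simp add: L_def)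
  moreover have "set (map C L) \<subseteq> range C" by auto
  ultimately have "8 \<le> card (range C)" by (metis card_mono finite finite_imageI)
  then show False using rank by (simp add: algebra_rank_eq_card_classes[OF coh] C_def)
qed


section \<open>Coherent rank of graphs with three eigenvalues\<close>

lemma card_range_le_card_range:
  fixes g :: "'a::finite \<Rightarrow> 'b" and h :: "'a \<Rightarrow> 'c"
  assumes "\<And>x y. h x = h y \<Longrightarrow> g x = g y"
  shows "card (range g) \<le> card (range h)"
proof -
  have "g x = g (inv h (h x))" for x by (rule assms) (simp add: f_inv_into_f)
  then have "range g \<subseteq> (g \<circ> inv h) ` range h" by (force simp: image_iff)
  then show ?thesis
    by (meson card_image_le card_mono finite finite_imageI le_trans)
qed

theorem theorem3p6:
  fixes \<Gamma> :: "'v::finite \<Rightarrow> 'v \<Rightarrow> bool"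
  assumes "\<Gamma> \<in> three_eigenvalue_graphs"
  shows "coherent_rank \<Gamma> \<noteq> 7"
proof
  assume "coherent_rank \<Gamma> = 7"
  define W where "W = coherent_closure \<Gamma>"
  define F where "F u = indicator_class W u u" for u
  define C where "C = (\<lambda>(u, v). indicator_class W u v)"
  have coh: "coherent_algebra W"
    unfolding W_def by (rule coherent_algebra_coherent_closure)
  have rank: "algebra_rank W = 7" "card (range C) = 7"
    using \<open>coherent_rank \<Gamma> = 7\<close> algebra_rank_eq_card_classes[OF coh]
    by (simp_all add: coherent_rank_def W_def C_def)
  have AW: "adjacency_matrix \<Gamma> \<in> W"
    unfolding W_def by (rule adjacency_matrix_in_coherent_closure)
  have adj_class: "\<Gamma> u v \<longleftrightarrow> \<Gamma> x y" if "indicator_class W u v = indicator_class W x y" for u v x y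
  proof -
    have "adjacency_matrix \<Gamma> $ u $ v = adjacency_matrix \<Gamma> $ x $ y"
      using that AW by (simp only: indicator_class_eq_iff)
    then show ?thesis by (simp add: adjacency_matrix_def of_bool_def split: if_splits)
  qed
  have sym: "\<Gamma> u v \<longleftrightarrow> \<Gamma> v u" and irrefl: "\<not> \<Gamma> u u" for u v
    using assms by (auto simp: three_eigenvalue_graphs_def simple_graph_def symp_def irreflp_def)
  have conn: "\<Gamma>\<^sup>*\<^sup>* u v" for u v
    using assms by (simp add: three_eigenvalue_graphs_def connected_graph_def)
  obtain s p \<alpha> where pos: "\<And>u. 0 < \<alpha> u"
    and walks: "\<And>u w. (\<Sum>z\<in>UNIV. of_bool (\<Gamma> u z) * of_bool (\<Gamma> z w)) =
      s * of_bool (\<Gamma> u w) - p * of_bool (u = w) + \<alpha> u * (\<alpha> w :: real)"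
    using three_eigenvalue_walk_count[OF assms] by blast
  have \<alpha>F: "\<alpha> u = \<alpha> x" if "F u = F x" for u x
  proof -
    define A where "A = adjacency_matrix \<Gamma>"
    have "A ** A \<in> W" using coh AW by (auto simp: coherent_algebra_def A_def)
    then have "(A ** A) $ u $ u = (A ** A) $ x $ x"
      using that unfolding F_def indicator_class_eq_iff by blast
    moreover have "(A ** A) $ z $ z = of_real (\<alpha> z * \<alpha> z - p)" for z
    proof -
      have "(A ** A) $ z $ z = of_real (\<Sum>t\<in>UNIV. of_bool (\<Gamma> z t) * of_bool (\<Gamma> t z))"
        by (simp only: A_def adjacency_matrix_def matrix_matrix_mult_def vec_lambda_beta
            of_real_sum of_real_mult of_real_of_bool)
      then show ?thesis by (simp only: walks) (simp add: irrefl)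
    qed
    ultimately have "\<alpha> u * \<alpha> u = \<alpha> x * \<alpha> x" by (simp only: of_real_eq_iff) 
    then show ?thesis using pos[of u] pos[of x] by (simp add: square_eq_iff flip: power2_eq_square)
  qed
  \<comment> \<open>If the weights are constant, the whole vertex set may serve as a single block, so that a pair is
    classified by being equal, adjacent or neither.\<close>
  have const: False if "\<And>u x. \<alpha> u = \<alpha> x"
  proof -
    define r where "r = \<alpha> undefined"
    have r: "\<alpha> u = r" for u unfolding r_def by (rule that)
    interpret walk_regular_join \<Gamma> "\<lambda>_. ()" s p "\<lambda>_. r"
      by unfold_locales (fact sym, fact irrefl, simp, simp only: walks r)
    define lab where "lab = (\<lambda>(u, v). (u = v, \<Gamma> u v))"
    have "card (range C) \<le> card (range lab)"
    proof (rule card_range_le_card_range)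
      fix a b assume "lab a = lab b"
      then show "C a = C b"
        by (cases a; cases b) (auto simp: C_def W_def lab_def indicator_class_eq_iff
            intro!: coherent_closure_entry_cong)
    qed
    also have "\<dots> \<le> card {(True, False), (False, True), (False, False)}"
      using irrefl by (intro card_mono) (auto simp: lab_def)
    also have "\<dots> = 3" by simp
    finally show False using rank by simp
  qed
  obtain u0 w0 where uw: "F u0 \<noteq> F w0" using const \<alpha>F by blast
  have two: "F u = F u0 \<or> F u = F w0" for u
  proof (rule ccontr)
    assume "\<not> ?thesis"
    then have ne: "F u \<noteq> F u0" "F u \<noteq> F w0" by auto
    then have "u \<noteq> u0" "u \<noteq> w0" "u0 \<noteq> w0" using uw by auto
    then have "card {u, u0, w0} = 3" by simp
    moreover have "inj_on F {u, u0, w0}" using ne uw by (auto simp: inj_on_def)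
    ultimately have "9 \<le> algebra_rank W"
      unfolding F_def by (rule rank_three_fibres[OF coh])
    then show False using rank by simp
  qed
  have join: "\<Gamma> u v" if uv: "F u \<noteq> F v" for u v
  proof (rule ccontr)
    assume no: "\<not> \<Gamma> u v"
    \<comment> \<open>Positions between the fibres form one class up to transposition, so if \<open>u\<close> and \<open>v\<close> are not
      adjacent, then no edge joins the fibres.\<close>
    have cross: "\<not> \<Gamma> x y" if "F x \<noteq> F y" for x y
    proof -
      have "F x = F u \<and> F y = F v \<or> F x = F v \<and> F y = F u"
        using two[of x] two[of y] two[of u] two[of v] uv that by metis
      moreover have "indicator_class W x y = indicator_class W a b" if "F x = F a" "F y = F b" for a b
        using rank_two_fibres_cross[OF coh, of x a y b] rank that \<open>F x \<noteq> F y\<close> by (simp add: F_def)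
      ultimately have "indicator_class W x y = indicator_class W u v
          \<or> indicator_class W x y = indicator_class W v u" by blast
      then show ?thesis using adj_class no sym by metis
    qed
    have "F u = F x" if "\<Gamma>\<^sup>*\<^sup>* u x" for x
      using that by induction (use cross in metis)+
    then show False using conn uv by blast
  qed
  define \<beta> where "\<beta> c = \<alpha> (inv F c)" for c
  have \<beta>: "\<beta> (F u) = \<alpha> u" for u
    unfolding \<beta>_def by (rule \<alpha>F) (simp add: f_inv_into_f)
  interpret walk_regular_join \<Gamma> F s p \<beta>
    by unfold_locales (fact sym, fact irrefl, fact join, simp only: walks \<beta>)
  define lab where "lab = (\<lambda>(u, v). (F u, F v, u = v, \<Gamma> u v))"
  \<comment> \<open>The labels \<open>lab\<close> and the classes \<open>C\<close> partition the pairs of vertices in the same way.\<close>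
  have lab_C: "C a = C b" if "lab a = lab b" for a b
    using that by (cases a; cases b) (auto simp: C_def W_def lab_def indicator_class_eq_iff
      intro!: coherent_closure_entry_cong)
  have C_lab: "lab a = lab b" if "C a = C b" for a b
  proof (cases a; cases b)
    fix u v x y assume ab: "a = (u, v)" "b = (x, y)"
    then have "indicator_class W u v = indicator_class W x y" using that by (simp add: C_def)
    from fibre_source[OF coh this] fibre_target[OF coh this] indicator_class_diagonal[OF coh this]
      adj_class[OF this]
    show ?thesis by (simp add: ab lab_def F_def)
  qed
  have card_lab: "card (range lab) = 7"
    using card_range_le_card_range[of lab C, OF lab_C] card_range_le_card_range[of C lab, OF C_lab]
      rank by linarith
  \<comment> \<open>Whether block \<open>k\<close> contains an edge, respectively a pair of distinct nonadjacent vertices.\<close>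
  define e where "e k \<longleftrightarrow> (\<exists>u v. F u = k \<and> F v = k \<and> \<Gamma> u v)" for k
  define n where "n k \<longleftrightarrow> (\<exists>u v. F u = k \<and> F v = k \<and> u \<noteq> v \<and> \<not> \<Gamma> u v)" for k
  \<comment> \<open>The case excluded by the equality of weights: \<open>k\<close> is complete or empty, and \<open>m\<close> has an edge.\<close>
  have key: False if k: "k \<noteq> m" "\<And>u. F u = k \<or> F u = m" and "e m"
    and triv: "e k \<and> \<not> n k \<or> n k \<and> \<not> e k" for k m
  proof -
    obtain u v where uv: "F u = m" "F v = m" "\<Gamma> u v" using \<open>e m\<close> by (auto simp: e_def)
    obtain x y where xy: "F x = k" "F y = k" "x \<noteq> y"
      using triv irrefl unfolding e_def n_def by metis
    have "(\<forall>x y. F x = k \<longrightarrow> F y = k \<longrightarrow> \<not> \<Gamma> x y) \<or>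
      (\<forall>x y. F x = k \<longrightarrow> F y = k \<longrightarrow> x \<noteq> y \<longrightarrow> \<Gamma> x y)"
      using triv unfolding e_def n_def by blast
    moreover have "0 < \<beta> m" "0 < \<beta> k" using pos \<beta> uv(1) xy(1) by metis+
    ultimately have "\<beta> m = \<beta> k"
      using weights_eq[of m k u v x y] k k(1)[symmetric] uv xy by blast
    moreover have "\<alpha> w = \<beta> k \<or> \<alpha> w = \<beta> m" for w using k(2)[of w] \<beta>[of w] by auto
    ultimately show False using const by metis
  qed
  define c d where "c = F u0" and "d = F w0"
  have cd: "c \<noteq> d" "d \<noteq> c" using uw by (auto simp: c_def d_def)
  have blocks: "F u = c \<or> F u = d" for u using two by (simp add: c_def d_def)
  \<comment> \<open>The first four labels always occur; each of the other four may be missing.\<close>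
  define T where "T = {(c, c, True, False), (d, d, True, False), (c, d, False, True), (d, c, False, True)}
    \<union> (if e c then {(c, c, False, True)} else {}) \<union> (if n c then {(c, c, False, False)} else {})
    \<union> (if e d then {(d, d, False, True)} else {}) \<union> (if n d then {(d, d, False, False)} else {})"
  have "range lab = T"
  proof
    have "lab (u, v) \<in> T" for u v
    proof (cases "F u = F v")
      case True
      have "e (F u)" if "\<Gamma> u v" using True that unfolding e_def by metis
      moreover have "n (F u)" if "u \<noteq> v" "\<not> \<Gamma> u v" using True that unfolding n_def by metis
      ultimately show ?thesis using blocks[of u] True irrefl[of u]
        by (cases "u = v"; cases "\<Gamma> u v") (auto simp: lab_def T_def)
    next
      case False
      then show ?thesis using blocks[of u] blocks[of v] join[of u v] by (auto simp: lab_def T_def)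
    qed
    then show "range lab \<subseteq> T" by auto
    have r: "(F u, F v, u = v, \<Gamma> u v) \<in> range lab" for u v
      by (rule image_eqI[of _ _ "(u, v)"]) (simp_all add: lab_def)
    have "(c, c, True, False) \<in> range lab" "(d, d, True, False) \<in> range lab"
      using r[of u0 u0] r[of w0 w0] irrefl by (simp_all add: c_def d_def)
    moreover have "(c, d, False, True) \<in> range lab" "(d, c, False, True) \<in> range lab"
      using r[of u0 w0] r[of w0 u0] join[OF uw] join[OF uw[symmetric]] uw
      by (cases "u0 = w0"; simp add: c_def d_def eq_commute[of w0 u0])+
    moreover have "(k, k, False, True) \<in> range lab" if "e k" for k
    proof -
      obtain u v where "F u = k" "F v = k" "\<Gamma> u v" using \<open>e k\<close> unfolding e_def by blast
      then show ?thesis using r[of u v] irrefl[of u] by (cases "u = v") auto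
    qed
    moreover have "(k, k, False, False) \<in> range lab" if "n k" for k
    proof -
      obtain u v where "F u = k" "F v = k" "u \<noteq> v" "\<not> \<Gamma> u v"
        using \<open>n k\<close> unfolding n_def by blast
      then show ?thesis using r[of u v] by simp
    qed
    ultimately show "T \<subseteq> range lab" by (auto simp: T_def)
  qed
  then have "card T = 7" using card_lab by simp
  then have "e d \<and> (e c \<and> \<not> n c \<or> n c \<and> \<not> e c) \<or> e c \<and> (e d \<and> \<not> n d \<or> n d \<and> \<not> e d)"
    using cd by (cases "e c"; cases "n c"; cases "e d"; cases "n d") (simp_all add: T_def)
  then consider "e d" "e c \<and> \<not> n c \<or> n c \<and> \<not> e c" | "e c" "e d \<and> \<not> n d \<or> n d \<and> \<not> e d"
    by blast
  then show False
  proof cases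
    case 1
    show False by (rule key[OF cd(1) blocks 1])
  next
    case 2
    have "F u = d \<or> F u = c" for u using blocks by blast
    from key[OF cd(2) this 2] show False .
  qed
qed

end
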